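(* Let $(\mathcal{P}_1,\mathcal{V}_1)$ be a locally convex cone and let $(\mathcal{P}_2,\mathcal{V}_2)$ be a separated full locally convex cone which is complete under the symmetric topology. Let $v\in\mathcal{V}_2$ be a bounded element and assume that a mapping $f:\mathcal{P}_1\to\mathcal{P}_2$ satisfies $$2f\left(\frac{x+y}{2}\right)+2f\left(\frac{x-y}{2}\right)\in v\bigl(f(x)+f(y)\bigr)v$$ for all $x,y\in\mathcal{P}_1$ with $x-y\in\mathcal{P}_1$. If $f(0)$ is bounded, then there exists a unique quadratic function $Q:\mathcal{P}_1\to\mathcal{P}_2$ for which there is a positive real number $\gamma$ such that $$Q(x)\in(\gamma v)(f(x))(\gamma v)\quad\text{for all }x\in\mathcal{P}_1.$$
   Context: A cone is a set $\mathcal{P}$ with an associative, commutative addition having a neutral element $0$, and a multiplication by real scalars $\lambda\ge 0$ satisfying $\lambda(\mu a)=(\lambda\mu)a$, $(\lambda+\mu)a=\lambda a+\mu a$, $\lambda(a+b)=\lambda a+\lambda b$, $1a=a$, $0a=0$. No cancellation law is assumed. A preordered cone is a cone with a reflexive transitive relation $\le$ (not necessarily antisymmetric) such that $a\le b$ implies $a+c\le b+c$ and $\lambda a\le\lambda b$ for all $c$ and all $\lambda\ge0$. An abstract $0$-neighborhood system in a preordered cone $\mathcal{P}$ is a subset $\mathcal{V}\subseteq\mathcal{P}$ such that: (i) $0<v$ for all $v\in\mathcal{V}$; (ii) for all $u,v\in\mathcal{V}$ there is $w\in\mathcal{V}$ with $w\le u$ and $w\le v$; (iii) $u+v\in\mathcal{V}$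 and $\lambda v\in\mathcal{V}$ for all $u,v\in\mathcal{V}$, $\lambda>0$. A full locally convex cone $(\mathcal{P},\mathcal{V})$ is a preordered cone $\mathcal{P}$ with an abstract $0$-neighborhood system $\mathcal{V}\subseteq\mathcal{P}$ such that every element is bounded below: for every $a\in\mathcal{P}$, $v\in\mathcal{V}$ there is $\rho>0$ with $0\le a+\rho v$. A locally convex cone $(\mathcal{P},\mathcal{V})$ is a subcone $\mathcal{P}$ (nonempty subset closed under addition and multiplication by non-negative reals) of a full locally convex cone with $0$-neighborhood system $\mathcal{V}$; $\mathcal{P}$ need not contain $\mathcal{V}$. For $a\in\mathcal{P}$, $v\in\mathcal{V}$: the upper neighborhood is $v(a)=\{b\in\mathcal{P}: b\le a+v\}$, the lower neighborhood is $(a)v=\{b\in\mathcal{P}: a\le b+v\}$, and the symmetric neighborhood is $v(a)v=v(a)\cap(a)v$. Thus $b\in(\gamma v)(a)(\gamma v)$ means $b\le a+\gamma v$ and $a\le b+\gamma v$. The symmetric neighborhoods generate the symmetric topology. An element $a$ is bounded if it is bounded below (for every $v\in\mathcal{V}$ there is $\rho>0$ with $0\le a+\rho v$) and upper bounded: for every $v\in\mathcal{V}$ there is $\lambda>0$ with $a\le\lambda v$. The closure of $a$ is $\overline{a}=\bigcap_{v\in\mathcal{V}}v(a)$, and $(\mathcal{P},\mathcal{V})$ is separated if $\overline{a}=\overline{b}$ implies $a=b$. A net $(a_i)_{i\in I}$ converges to $a$ in the symmetric topology if for every $v\in\mathcal{V}$ there is $i_0$ with $a_i\le a+v$ and $a\le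 a_i+v$ for all $i\ge i_0$; it is a symmetric Cauchy net if for every $v\in\mathcal{V}$ there is $i_0$ with $a_i\le a_j+v$ for all $i,j\ge i_0$. $(\mathcal{P},\mathcal{V})$ is complete under the symmetric topology if every symmetric Cauchy net converges in the symmetric topology to an element of $\mathcal{P}$. In a cone, "$x-y\in\mathcal{P}$" means that there is $z\in\mathcal{P}$ with $x=y+z$, and $x-y$ stands for such a $z$ (conditions involving $x-y$ are required for every such $z$). A function $Q:\mathcal{P}_1\to\mathcal{P}_2$ between cones is quadratic if $Q(x+y)+Q(x-y)=2Q(x)+2Q(y)$ for all $x,y\in\mathcal{P}_1$ with $x-y\in\mathcal{P}_1$. *)

theory Defs
  imports Complex_Main "HOL-Library.FuncSet"
begin

text \<open>
  A cone only carries multiplication by non-negative reals, so the axioms below say nothing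
  about scalars \<open>r < 0\<close>. Addition need not be cancellative, so \<open>real_vector\<close> does not
  apply and there is no subtraction on the type.
\<close>

class cone_space = comm_monoid_add + scaleR +
  assumes cone_scale_scale: "0 \<le> r \<Longrightarrow> 0 \<le> s \<Longrightarrow> r *\<^sub>R (s *\<^sub>R a) = (r * s) *\<^sub>R a"
    and cone_scale_add_left: "0 \<le> r \<Longrightarrow> 0 \<le> s \<Longrightarrow> (r + s) *\<^sub>R a = r *\<^sub>R a + s *\<^sub>R a"
    and cone_scale_add_right: "0 \<le> r \<Longrightarrow> r *\<^sub>R (a + b) = r *\<^sub>R a + r *\<^sub>R b"
    and cone_scale_one: "1 *\<^sub>R a = a"
    and cone_scale_zero: "0 *\<^sub>R a = 0"

text \<open>
  The class \<open>preorder\<close> does not assume antisymmetry; its strict part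
  \<open>a < b\<close> means \<open>a \<le> b\<close> and not \<open>b \<le> a\<close>.
\<close>

class preordered_cone = cone_space + preorder +
  assumes preordered_cone_add_right_mono: "a \<le> b \<Longrightarrow> a + c \<le> b + c"
    and preordered_cone_scale_mono: "a \<le> b \<Longrightarrow> 0 \<le> r \<Longrightarrow> r *\<^sub>R a \<le> r *\<^sub>R b"

definition subcone :: "'a::cone_space set \<Rightarrow> bool" where
  "subcone P \<longleftrightarrow> P \<noteq> {} \<and> (\<forall>a\<in>P. \<forall>b\<in>P. a + b \<in> P) \<and> (\<forall>a\<in>P. \<forall>r\<ge>0. r *\<^sub>R a \<in> P)"

definition abstract_nbhd_system :: "'a::preordered_cone set \<Rightarrow> 'a set \<Rightarrow> bool" where
  "abstract_nbhd_system P V \<longleftrightarrow>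
     V \<subseteq> P \<and>
     (\<forall>v\<in>V. 0 < v) \<and>
     (\<forall>u\<in>V. \<forall>v\<in>V. \<exists>w\<in>V. w \<le> u \<and> w \<le> v) \<and>
     (\<forall>u\<in>V. \<forall>v\<in>V. u + v \<in> V) \<and>
     (\<forall>v\<in>V. \<forall>r>0. r *\<^sub>R v \<in> V)"

definition bounded_below_elem :: "'a::preordered_cone set \<Rightarrow> 'a \<Rightarrow> bool" where
  "bounded_below_elem V a \<longleftrightarrow> (\<forall>v\<in>V. \<exists>\<rho>>0. 0 \<le> a + \<rho> *\<^sub>R v)"

definition upper_bounded_elem :: "'a::preordered_cone set \<Rightarrow> 'a \<Rightarrow> bool" where
  "upper_bounded_elem V a \<longleftrightarrow> (\<forall>v\<in>V. \<exists>r>0. a \<le> r *\<^sub>R v)"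

definition bounded_elem :: "'a::preordered_cone set \<Rightarrow> 'a \<Rightarrow> bool" where
  "bounded_elem V a \<longleftrightarrow> bounded_below_elem V a \<and> upper_bounded_elem V a"

definition full_locally_convex_cone :: "'a::preordered_cone set \<Rightarrow> 'a set \<Rightarrow> bool" where
  "full_locally_convex_cone P V \<longleftrightarrow>
     subcone P \<and> abstract_nbhd_system P V \<and> (\<forall>a\<in>P. bounded_below_elem V a)"

definition locally_convex_cone :: "'a::preordered_cone set \<Rightarrow> 'a set \<Rightarrow> bool" where
  "locally_convex_cone P V \<longleftrightarrow>
     subcone P \<and> (\<exists>F. full_locally_convex_cone F V \<and> P \<subseteq> F)"

definition upper_nbhd :: "'a::preordered_cone set \<Rightarrow> 'a \<Rightarrow> 'a \<Rightarrow> 'a set" where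
  "upper_nbhd P v a = {b \<in> P. b \<le> a + v}"

definition lower_nbhd :: "'a::preordered_cone set \<Rightarrow> 'a \<Rightarrow> 'a \<Rightarrow> 'a set" where
  "lower_nbhd P v a = {b \<in> P. a \<le> b + v}"

definition sym_nbhd :: "'a::preordered_cone set \<Rightarrow> 'a \<Rightarrow> 'a \<Rightarrow> 'a set" where
  "sym_nbhd P v a = upper_nbhd P v a \<inter> lower_nbhd P v a"

definition elem_closure :: "'a::preordered_cone set \<Rightarrow> 'a set \<Rightarrow> 'a \<Rightarrow> 'a set" where
  "elem_closure P V a = (\<Inter>v\<in>V. upper_nbhd P v a)"

definition separated_cone :: "'a::preordered_cone set \<Rightarrow> 'a set \<Rightarrow> bool" where
  "separated_cone P V \<longleftrightarrow>
     (\<forall>a\<in>P. \<forall>b\<in>P. elem_closure P V a = elem_closure P V b \<longrightarrow> a = b)"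

text \<open>In a directed index set, \<open>(i, j) \<in> R\<close> reads \<open>j \<ge> i\<close>.\<close>

definition directed_index :: "'i set \<Rightarrow> 'i rel \<Rightarrow> bool" where
  "directed_index I R \<longleftrightarrow>
     I \<noteq> {} \<and> preorder_on I R \<and> (\<forall>i\<in>I. \<forall>j\<in>I. \<exists>k\<in>I. (i, k) \<in> R \<and> (j, k) \<in> R)"

definition sym_converges ::
  "'a::preordered_cone set \<Rightarrow> 'i set \<Rightarrow> 'i rel \<Rightarrow> ('i \<Rightarrow> 'a) \<Rightarrow> 'a \<Rightarrow> bool" where
  "sym_converges V I R x a \<longleftrightarrow>
     (\<forall>v\<in>V. \<exists>i0\<in>I. \<forall>i\<in>I. (i0, i) \<in> R \<longrightarrow> x i \<le> a + v \<and> a \<le> x i + v)"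

definition sym_cauchy_net ::
  "'a::preordered_cone set \<Rightarrow> 'i set \<Rightarrow> 'i rel \<Rightarrow> ('i \<Rightarrow> 'a) \<Rightarrow> bool" where
  "sym_cauchy_net V I R x \<longleftrightarrow>
     (\<forall>v\<in>V. \<exists>i0\<in>I. \<forall>i\<in>I. \<forall>j\<in>I. (i0, i) \<in> R \<longrightarrow> (i0, j) \<in> R \<longrightarrow> x i \<le> x j + v)"

text \<open>
  A definition in HOL cannot quantify over the type of the index set, so completeness is stated
  for nets whose directed index set consists of elements of the ambient type. This is no
  restriction: by \<open>sym_complete_net\<close> below, symmetric Cauchy nets over directed sets of any type
  then converge as well.
\<close>

definition sym_complete :: "'a::preordered_cone set \<Rightarrow> 'a set \<Rightarrow> bool" where
  "sym_complete P V \<longleftrightarrow>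
     (\<forall>(I::'a set) R x. directed_index I R \<longrightarrow> x \<in> I \<rightarrow> P \<longrightarrow> sym_cauchy_net V I R x \<longrightarrow>
        (\<exists>a\<in>P. sym_converges V I R x a))"

text \<open>
  \<open>x - y \<in> P\<close> means that \<open>x = y + z\<close> for some \<open>z \<in> P\<close>. Such a \<open>z\<close> need not be unique, and
  the functional equation is required for each of them.
\<close>

definition quadratic_on :: "'a::cone_space set \<Rightarrow> ('a \<Rightarrow> 'b::cone_space) \<Rightarrow> bool" where
  "quadratic_on P Q \<longleftrightarrow>
     (\<forall>x\<in>P. \<forall>y\<in>P. \<forall>z\<in>P. x = y + z \<longrightarrow> Q (x + y) + Q z = 2 *\<^sub>R Q x + 2 *\<^sub>R Q y)"

lemma sym_complete_net:
  fixes P V F :: "'a::preordered_cone set" and I :: "'i set"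
  assumes V: "abstract_nbhd_system F V" and C: "sym_complete P V"
    and I: "directed_index I R" and x: "x \<in> I \<rightarrow> P" and cauchy: "sym_cauchy_net V I R x"
  shows "\<exists>a\<in>P. sym_converges V I R x a"
proof (cases "V = {}")
  case True
  then show ?thesis using I x by (fastforce simp: directed_index_def sym_converges_def)
next
  case False
  define N where "N v i \<longleftrightarrow> i \<in> I \<and> (\<forall>j\<in>I. \<forall>k\<in>I. (i, j) \<in> R \<longrightarrow> (i, k) \<in> R \<longrightarrow> x j \<le> x k + v)"
    for v i
  define n where "n v = (SOME i. N v i)" for v
  have n: "N v (n v)" if "v \<in> V" for v
    using cauchy that unfolding n_def sym_cauchy_net_def N_def by (intro someI_ex[of "N v", unfolded N_def]) blast
  then have nI: "n v \<in> I" if "v \<in> V" for v using that by (simp add: N_def)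
  have refl: "(i, i) \<in> R" if "i \<in> I" for i
    using I that by (simp add: directed_index_def preorder_on_def refl_on_def)
  have trans: "trans R" using I by (simp add: directed_index_def preorder_on_def)
  define S where "S = {(u, w). u \<in> V \<and> w \<in> V \<and> w \<le> u}"
  have S: "directed_index V S"
  proof -
    have "preorder_on V S"
      by (auto simp: preorder_on_def S_def refl_on_def intro!: transI dest: order_trans)
    moreover have "\<exists>k\<in>V. (i, k) \<in> S \<and> (j, k) \<in> S" if "i \<in> V" "j \<in> V" for i j
      using V that unfolding abstract_nbhd_system_def S_def by blast
    ultimately show ?thesis using False by (simp add: directed_index_def)
  qed
  have half: "(1/2) *\<^sub>R v \<in> V" and half_eq: "a + (1/2) *\<^sub>R v + (1/2) *\<^sub>R v = a + v" if "v \<in> V" for v a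
  proof -
    show "(1/2) *\<^sub>R v \<in> V" using V that by (simp add: abstract_nbhd_system_def)
    have "(1/2) *\<^sub>R v + (1/2) *\<^sub>R v = v"
      using cone_scale_add_left[of "1/2" "1/2" v] by (simp add: cone_scale_one)
    then show "a + (1/2) *\<^sub>R v + (1/2) *\<^sub>R v = a + v" by (simp add: add.assoc)
  qed
  have mono: "a + u \<le> a' + u'" if "a \<le> a'" "u \<le> u'" for a a' u u' :: 'a
    using preordered_cone_add_right_mono[OF that(1), of u]
      preordered_cone_add_right_mono[OF that(2), of a'] by (metis add.commute order_trans)
  have close: "x (n u) \<le> x k + u" "x k \<le> x (n u) + u" if "u \<in> V" "k \<in> I" "(n u, k) \<in> R" for u k
    using n[OF that(1)] that(2,3) refl[OF nI[OF that(1)]] by (auto simp: N_def)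
  have "sym_cauchy_net V V S (x \<circ> n)"
    unfolding sym_cauchy_net_def
  proof
    fix v assume v: "v \<in> V"
    have "x (n u) \<le> x (n w) + v" if uw: "u \<in> V" "w \<in> V" "u \<le> (1/2) *\<^sub>R v" "w \<le> (1/2) *\<^sub>R v" for u w
    proof -
      obtain k where k: "k \<in> I" "(n u, k) \<in> R" "(n w, k) \<in> R"
        using I nI uw(1,2) unfolding directed_index_def by blast
      have "x (n u) \<le> x k + u" using close uw k by blast
      also have "\<dots> \<le> (x (n w) + w) + u" using close(2)[OF uw(2) k(1,3)] by (intro mono) auto
      also have "\<dots> \<le> (x (n w) + (1/2) *\<^sub>R v) + (1/2) *\<^sub>R v" using uw by (intro mono) auto
      finally show ?thesis using half_eq[OF v] by simp
    qed
    then show "\<exists>i0\<in>V. \<forall>i\<in>V. \<forall>j\<in>V. (i0, i) \<in> S \<longrightarrow> (i0, j) \<in> S \<longrightarrow> (x \<circ> n) i \<le> (x \<circ> n) j + v"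
      using half[OF v] by (intro bexI[of _ "(1/2) *\<^sub>R v"]) (auto simp: S_def)
  qed
  moreover have "x \<circ> n \<in> V \<rightarrow> P" using x nI by auto
  ultimately obtain a where a: "a \<in> P" "sym_converges V V S (x \<circ> n) a"
    using C S unfolding sym_complete_def by blast
  have "sym_converges V I R x a"
    unfolding sym_converges_def
  proof
    fix v assume v: "v \<in> V"
    obtain u0 where u0: "u0 \<in> V"
      "\<And>u. u \<in> V \<Longrightarrow> u \<le> u0 \<Longrightarrow> x (n u) \<le> a + (1/2) *\<^sub>R v \<and> a \<le> x (n u) + (1/2) *\<^sub>R v"
      using a(2) half[OF v] unfolding sym_converges_def S_def by fastforce
    obtain u where u: "u \<in> V" "u \<le> u0" "u \<le> (1/2) *\<^sub>R v"
      using V u0(1) half[OF v] unfolding abstract_nbhd_system_def by blast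
    have "x i \<le> a + v \<and> a \<le> x i + v" if i: "i \<in> I" "(n u, i) \<in> R" for i
    proof
      have "x i \<le> x (n u) + u" using close u i by blast
      also have "\<dots> \<le> (a + (1/2) *\<^sub>R v) + (1/2) *\<^sub>R v" using u u0(2) by (intro mono) auto
      finally show "x i \<le> a + v" using half_eq[OF v] by simp
      have "a \<le> x (n u) + (1/2) *\<^sub>R v" using u u0(2) by blast
      also have "\<dots> \<le> (x i + u) + (1/2) *\<^sub>R v" using close(1)[OF u(1) i] by (intro mono) auto
      also have "\<dots> \<le> (x i + (1/2) *\<^sub>R v) + (1/2) *\<^sub>R v" using u by (intro mono) auto
      finally show "a \<le> x i + v" using half_eq[OF v] by simp
    qed
    then show "\<exists>i0\<in>I. \<forall>i\<in>I. (i0, i) \<in> R \<longrightarrow> x i \<le> a + v \<and> a \<le> x i + v"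
      using nI[OF u(1)] by blast
  qed
  then show ?thesis using a(1) by blast
qed

end

(*
  Taking y = 0 in the hypothesis gives 4 f(x) close to f(2x) + f(0). As f(0) is bounded, it is
  absorbed into a multiple of v, so the sequence f(2^n x) / 4^n moves by O(4^-n) v at each step.
  Since v is bounded, 4^-n v is eventually below every neighborhood: the sequence is Cauchy and its
  limit Q(x) is within a multiple of v of f(x). The hypothesis passes to the limit without error,
  and Q(2x) = 4 Q(x) turns it into the quadratic equation. For uniqueness, a quadratic function
  near f has a bounded value at 0, and 2 Q(0) = 4 Q(0) then forces Q(0) = 0 in a separated cone;
  so Q(2x) = 4 Q(x), and scaling shrinks the distance between two such functions to nothing.
*)

theory Submission
  imports Defs
begin

section \<open>Closeness up to a given element, sequential limits, and arithmetic in cones\<close>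

definition near :: "'a::preordered_cone \<Rightarrow> 'a \<Rightarrow> 'a \<Rightarrow> bool" where
  "near u a b \<longleftrightarrow> a \<le> b + u \<and> b \<le> a + u"

text \<open>Symmetric convergence indexed by \<open>nat\<close>, phrased with a filter so that
  finitely many conditions on the tail can be combined by \<open>eventually_elim\<close>.\<close>

definition seq_lim :: "'a::preordered_cone set \<Rightarrow> (nat \<Rightarrow> 'a) \<Rightarrow> 'a \<Rightarrow> bool" where
  "seq_lim V x a \<longleftrightarrow> (\<forall>w\<in>V. \<forall>\<^sub>F n in sequentially. near w (x n) a)"

lemma sym_nbhd_iff_near: "b \<in> sym_nbhd P u a \<longleftrightarrow> b \<in> P \<and> near u b a"
  by (auto simp: sym_nbhd_def upper_nbhd_def lower_nbhd_def near_def)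

lemma cone_add_mono:
  fixes a b c d :: "'a::preordered_cone"
  assumes "a \<le> b" "c \<le> d"
  shows "a + c \<le> b + d"
  using preordered_cone_add_right_mono[OF assms(1), of c]
    preordered_cone_add_right_mono[OF assms(2), of b]
  by (metis add.commute order_trans)

lemma cone_scale_zero_right:
  fixes a :: "'a::cone_space"
  shows "0 \<le> r \<Longrightarrow> r *\<^sub>R (0::'a) = 0"
  by (metis cone_scale_scale cone_scale_zero mult_zero_right order_refl)

lemma cone_scale_two: "2 *\<^sub>R a = a + (a::'a::cone_space)"
  using cone_scale_add_left[of 1 1 a] by (simp add: cone_scale_one)

lemma cone_scale_mono_left:
  fixes v :: "'a::preordered_cone"
  assumes "0 \<le> v" "0 \<le> r" "r \<le> s"
  shows "r *\<^sub>R v \<le> s *\<^sub>R v"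
proof -
  have "0 \<le> (s - r) *\<^sub>R v"
    using preordered_cone_scale_mono[OF assms(1), of "s - r"] assms(3)
    by (simp add: cone_scale_zero_right)
  then have "r *\<^sub>R v + 0 \<le> r *\<^sub>R v + (s - r) *\<^sub>R v" by (rule cone_add_mono[OF order_refl])
  also have "\<dots> = s *\<^sub>R v" using cone_scale_add_left[of r "s - r" v] assms by simp
  finally show ?thesis by simp
qed

section \<open>Calculus of symmetric errors\<close>

lemma near_sym: "near u a b \<Longrightarrow> near u b a"
  by (auto simp: near_def)

lemma near_mono: "near u a b \<Longrightarrow> u \<le> w \<Longrightarrow> near w a b"
  unfolding near_def by (meson cone_add_mono order_refl order_trans)

lemma near_refl: "0 \<le> u \<Longrightarrow> near u a a"
  unfolding near_def using cone_add_mono[of a a 0 u] by simp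

lemma near_trans:
  assumes "near u a b" "near w b c"
  shows "near (u + w) a c"
proof -
  have "a \<le> b + u" "b + u \<le> (c + w) + u" "c \<le> b + w" "b + w \<le> (a + u) + w"
    using assms by (auto simp: near_def intro: cone_add_mono)
  then show ?thesis unfolding near_def by (metis add.assoc add.commute order_trans)
qed

lemma near_add:
  assumes "near u a b" "near w c d"
  shows "near (u + w) (a + c) (b + d)"
proof -
  have "a + c \<le> (b + u) + (d + w)" "b + d \<le> (a + u) + (c + w)"
    using assms by (auto simp: near_def intro: cone_add_mono)
  then show ?thesis by (simp add: near_def ac_simps)
qed

lemma near_scale: "near u a b \<Longrightarrow> 0 \<le> r \<Longrightarrow> near (r *\<^sub>R u) (r *\<^sub>R a) (r *\<^sub>R b)"
  unfolding near_def by (metis cone_scale_add_right preordered_cone_scale_mono)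

text \<open>Every error estimate below is a multiple of one fixed \<open>v\<close>; composing two of
  them then amounts to adding real coefficients.\<close>

lemma near_trans_scale:
  assumes "near (r *\<^sub>R v) a b" "near (s *\<^sub>R v) b c" "0 \<le> r" "0 \<le> s"
  shows "near ((r + s) *\<^sub>R v) a c"
  using near_trans[OF assms(1,2)] assms(3,4) by (simp add: cone_scale_add_left)

section \<open>Separation, limits, and completeness along vanishing multiples of one element\<close>

lemma nbhd_halves:
  assumes "abstract_nbhd_system P V" "w \<in> V"
  obtains h where "h \<in> V" "h + h = w"
proof
  show "(1/2) *\<^sub>R w \<in> V" using assms by (simp add: abstract_nbhd_system_def)
  show "(1/2) *\<^sub>R w + (1/2) *\<^sub>R w = w"
    using cone_scale_add_left[of "1/2" "1/2" w] by (simp add: cone_scale_one)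
qed

text \<open>Separation speaks of closures. If \<open>s\<close> and \<open>t\<close> agree up to
  every neighborhood, halving a neighborhood carries membership in the closure of \<open>s\<close>
  over to that of \<open>t\<close>; by symmetry the two closures coincide.\<close>

lemma separated_near_imp_eq:
  assumes V: "abstract_nbhd_system F V" and sep: "separated_cone P V" and "a \<in> P" "b \<in> P"
    and near: "\<And>w. w \<in> V \<Longrightarrow> near w a b"
  shows "a = b"
proof -
  have sub: "elem_closure P V s \<subseteq> elem_closure P V t" if st: "\<And>w. w \<in> V \<Longrightarrow> near w s t" for s t
    unfolding elem_closure_def upper_nbhd_def
  proof (intro subsetI INT_I CollectI conjI)
    fix c w assume c: "c \<in> (\<Inter>v\<in>V. {b \<in> P. b \<le> s + v})" and w: "w \<in> V"
    then show "c \<in> P" by auto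
    obtain h where h: "h \<in> V" "h + h = w" using nbhd_halves[OF V w] .
    have "c \<le> s + h" using c h by blast
    also have "\<dots> \<le> (t + h) + h"
      using st[OF h(1)] by (auto simp: near_def intro: cone_add_mono)
    finally show "c \<le> t + w" using h(2) by (simp add: add.assoc)
  qed
  have "elem_closure P V a = elem_closure P V b"
    by (intro equalityI sub near near_sym[OF near])
  then show ?thesis using sep assms(3,4) by (simp add: separated_cone_def)
qed

lemma seq_lim_add:
  assumes V: "abstract_nbhd_system P V" and "seq_lim V x a" "seq_lim V y b"
  shows "seq_lim V (\<lambda>n. x n + y n) (a + b)"
  unfolding seq_lim_def
proof
  fix w assume "w \<in> V"
  then obtain h where h: "h \<in> V" "h + h = w" using nbhd_halves[OF V] by blast
  have "\<forall>\<^sub>F n in sequentially. near h (x n) a" "\<forall>\<^sub>F n in sequentially. near h (y n) b"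
    using assms(2,3) h(1) by (auto simp: seq_lim_def)
  then show "\<forall>\<^sub>F n in sequentially. near w (x n + y n) (a + b)"
    by eventually_elim (use near_add h(2) in blast)
qed

lemma seq_lim_scale:
  assumes V: "abstract_nbhd_system P V" and "seq_lim V x a" "0 < r"
  shows "seq_lim V (\<lambda>n. r *\<^sub>R x n) (r *\<^sub>R a)"
  unfolding seq_lim_def
proof
  fix w assume "w \<in> V"
  then have "(1/r) *\<^sub>R w \<in> V" using V assms(3) by (simp add: abstract_nbhd_system_def)
  then have "\<forall>\<^sub>F n in sequentially. near ((1/r) *\<^sub>R w) (x n) a"
    using assms(2) by (auto simp: seq_lim_def)
  then show "\<forall>\<^sub>F n in sequentially. near w (r *\<^sub>R x n) (r *\<^sub>R a)"
  proof eventually_elim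
    case (elim n)
    from near_scale[OF this, of r] show ?case
      using assms(3) by (simp add: cone_scale_scale cone_scale_one)
  qed
qed

text \<open>Two asymptotically close sequences are allowed instead of one, so that an identity
  holding up to a vanishing error becomes an exact identity between the limits.\<close>

lemma seq_lim_unique:
  assumes V: "abstract_nbhd_system F V" and "separated_cone P V" "a \<in> P" "b \<in> P"
    and "seq_lim V x a" "seq_lim V y b"
    and xy: "\<And>w. w \<in> V \<Longrightarrow> \<forall>\<^sub>F n in sequentially. near w (x n) (y n)"
  shows "a = b"
proof (rule separated_near_imp_eq[OF assms(1-4)])
  fix w assume "w \<in> V"
  then obtain h where h: "h \<in> V" "h + h = w" using nbhd_halves[OF V] by blast
  obtain k where k: "k \<in> V" "k + k = h" using nbhd_halves[OF V h(1)] .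
  have "\<forall>\<^sub>F n in sequentially. near k (x n) a" "\<forall>\<^sub>F n in sequentially. near k (y n) b"
    using assms(5,6) k(1) by (auto simp: seq_lim_def)
  with xy[OF h(1)] have "\<forall>\<^sub>F n in sequentially. near w a b"
  proof eventually_elim
    case (elim n)
    then have "near (k + h + k) a b" using near_trans near_sym by blast
    then show ?case using h(2) k(2) by (metis add.assoc add.commute)
  qed
  then show "near w a b" by simp
qed

text \<open>Upper boundedness gives one factor \<open>r\<close> with
  \<open>v \<le> r *\<^sub>R w\<close>, so any coefficient below \<open>1 / r\<close> brings
  \<open>v\<close> under \<open>w\<close>. This turns null sequences of reals into convergence with
  respect to \<open>V\<close>.\<close>

lemma upper_bounded_scale_tendsto_zero:
  assumes V: "abstract_nbhd_system P V" and v: "0 \<le> v" "upper_bounded_elem V v" and w: "w \<in> V"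
    and s: "s \<longlonglongrightarrow> 0" "\<And>n. 0 \<le> s n"
  shows "\<forall>\<^sub>F n in sequentially. s n *\<^sub>R v \<le> w"
proof -
  obtain r where r: "r > 0" "v \<le> r *\<^sub>R w" using v(2) w unfolding upper_bounded_elem_def by blast
  have "\<forall>\<^sub>F n in sequentially. s n < 1 / r" using s(1) r(1) by (auto simp: order_tendsto_iff)
  then show ?thesis
  proof eventually_elim
    case (elim n)
    have "s n *\<^sub>R v \<le> (1/r) *\<^sub>R v" using elim s(2) v(1) by (intro cone_scale_mono_left) auto
    also have "\<dots> \<le> (1/r) *\<^sub>R (r *\<^sub>R w)" using r by (intro preordered_cone_scale_mono) auto
    also have "\<dots> = w" using r(1) by (simp add: cone_scale_scale cone_scale_one)
    finally show ?case .
  qed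
qed

lemma near_scale_tendsto_zero_imp_eq:
  assumes V: "abstract_nbhd_system F V" and "separated_cone P V" "a \<in> P" "b \<in> P"
    and v: "0 \<le> v" "upper_bounded_elem V v"
    and s: "s \<longlonglongrightarrow> 0" "\<And>n. 0 \<le> s n" and near: "\<And>n. near (s n *\<^sub>R v) a b"
  shows "a = b"
proof (rule separated_near_imp_eq[OF assms(1-4)])
  fix w assume "w \<in> V"
  from upper_bounded_scale_tendsto_zero[OF V v this s] obtain n where "s n *\<^sub>R v \<le> w"
    by (auto simp: eventually_sequentially)
  then show "near w a b" using near near_mono by blast
qed

text \<open>The step errors are written as differences of a decreasing sequence \<open>s\<close>, so
  their sum collapses and no geometric sum has to be evaluated.\<close>

lemma near_telescope:
  assumes "0 \<le> v" "decseq s" and step: "\<And>n. near ((s n - s (Suc n)) *\<^sub>R v) (x n) (x (Suc n))"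
    and "m \<le> n"
  shows "near ((s m - s n) *\<^sub>R v) (x m) (x n)"
  using \<open>m \<le> n\<close>
proof (induction n rule: dec_induct)
  \<comment> \<open>The radius is zero here, which is never an element of a neighborhood system;
    \<open>near\<close> therefore takes arbitrary elements as radius.\<close>
  case base
  show ?case by (simp add: cone_scale_zero near_refl)
next
  case (step n)
  have "s n \<le> s m" "s (Suc n) \<le> s n" using assms(2) step(1) by (auto simp: decseq_def)
  with near_trans_scale[OF step.IH assms(3)[of n]] show ?case by simp
qed

text \<open>From index \<open>m\<close> on, the sequence stays within \<open>s m *\<^sub>R v\<close>
  of \<open>x m\<close>, and these multiples drop below every neighborhood; hence it is
  Cauchy.\<close>

lemma sym_complete_telescope:
  assumes V: "abstract_nbhd_system F V" and "sym_complete P V" "range x \<subseteq> P"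
    and v: "v \<in> V" "upper_bounded_elem V v"
    and s: "decseq s" "s \<longlonglongrightarrow> 0"
    and step: "\<And>n. near ((s n - s (Suc n)) *\<^sub>R v) (x n) (x (Suc n))"
  obtains a where "a \<in> P" "seq_lim V x a" "near ((s 0 + 1) *\<^sub>R v) a (x 0)"
proof -
  let ?R = "{(i, j). i \<le> (j::nat)}"
  have v0: "0 \<le> v" using V v(1) by (auto simp: abstract_nbhd_system_def less_imp_le)
  have s0: "0 \<le> s n" for n using decseq_ge[OF s] .
  have tele: "near (s m *\<^sub>R v) (x m) (x n)" if "m \<le> n" for m n
  proof (rule near_mono[OF near_telescope[OF v0 s(1) step that]])
    show "(s m - s n) *\<^sub>R v \<le> s m *\<^sub>R v"
      using s0 s(1) that by (intro cone_scale_mono_left[OF v0]) (auto simp: decseq_def)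
  qed
  have I: "directed_index UNIV ?R"
    by (auto simp: directed_index_def preorder_on_def refl_on_def trans_def) (meson nle_le)
  have "sym_cauchy_net V UNIV ?R x"
    unfolding sym_cauchy_net_def
  proof
    fix w assume "w \<in> V"
    then obtain h where h: "h \<in> V" "h + h = w" using nbhd_halves[OF V] by blast
    from upper_bounded_scale_tendsto_zero[OF V v0 v(2) h(1) s(2) s0] obtain m
      where m: "s m *\<^sub>R v \<le> h" by (auto simp: eventually_sequentially)
    have "near w (x i) (x j)" if "m \<le> i" "m \<le> j" for i j
      using near_trans[OF near_sym[OF near_mono[OF tele[OF that(1)] m]]
          near_mono[OF tele[OF that(2)] m]] h(2) by simp
    then show "\<exists>i0\<in>UNIV. \<forall>i\<in>UNIV. \<forall>j\<in>UNIV. (i0, i) \<in> ?R \<longrightarrow> (i0, j) \<in> ?R \<longrightarrow> x i \<le> x j + w"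
      by (auto simp: near_def)
  qed
  then obtain a where a: "a \<in> P" "sym_converges V UNIV ?R x a"
    \<comment> \<open>The index set is \<open>nat\<close>, whereas \<open>sym_complete\<close>
      speaks of index sets inside the cone's own type; \<open>sym_complete_net\<close> bridges the
      two.\<close>
    using sym_complete_net[OF V assms(2) I, of x] assms(3) by blast
  have lim: "seq_lim V x a"
    using a(2) by (simp add: sym_converges_def seq_lim_def near_def eventually_sequentially)
  \<comment> \<open>The limit is replaced by one term \<open>x n\<close> within \<open>v\<close> of
    it: this costs the extra \<open>1\<close>, while telescoping from \<open>x 0\<close> to
    \<open>x n\<close> costs at most \<open>s 0\<close>.\<close>
  then obtain n where "near v (x n) a" using v(1) by (auto simp: seq_lim_def eventually_sequentially)
  then have "near ((s 0 + 1) *\<^sub>R v) (x 0) a"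
    using near_trans_scale[OF tele[of 0 n], of 1 a] s0 by (simp add: cone_scale_one)
  then show thesis using that a(1) lim near_sym by blast
qed

section \<open>Bounded elements and functions with Q(2x) = 4 Q(x)\<close>

lemma bounded_elem_near_zero:
  assumes "bounded_elem V a" "v \<in> V" "0 \<le> v"
  obtains c where "0 < c" "near (c *\<^sub>R v) a 0"
proof -
  obtain p q where pq: "p > 0" "0 \<le> a + p *\<^sub>R v" "q > 0" "a \<le> q *\<^sub>R v"
    using assms unfolding bounded_elem_def bounded_below_elem_def upper_bounded_elem_def by blast
  \<comment> \<open>The lower and upper bounds come with separate factors; the sum serves for
    both.\<close>
  have "p *\<^sub>R v \<le> (p + q) *\<^sub>R v" "q *\<^sub>R v \<le> (p + q) *\<^sub>R v"
    using pq assms(3) by (auto intro: cone_scale_mono_left)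
  then have "a \<le> (p + q) *\<^sub>R v" "0 \<le> a + (p + q) *\<^sub>R v"
    using pq cone_add_mono[of a a] order_trans by blast+
  then show thesis using that[of "p + q"] pq by (simp add: near_def)
qed

lemma tendsto_const_div_4_power: "(\<lambda>n. c / 4 ^ n) \<longlonglongrightarrow> (0::real)"
  using LIMSEQ_divide_realpow_zero[of 4 c] by simp

lemma subcone_zero: "subcone P \<Longrightarrow> 0 \<in> P"
  unfolding subcone_def by (metis cone_scale_zero equals0I order_refl)

text \<open>Without cancellation, \<open>2 *\<^sub>R Q 0 = 4 *\<^sub>R Q 0\<close> alone does not
  give \<open>Q 0 = 0\<close>. It does give that \<open>Q 0\<close> is fixed under halving, so the
  assumed distance from \<open>Q 0\<close> to zero can be halved forever.\<close>

lemma quadratic_on_double: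
  assumes P: "subcone P1" and Q: "quadratic_on P1 Q" "Q \<in> P1 \<rightarrow> P2"
    and V: "abstract_nbhd_system F V" "separated_cone P2 V" "0 \<in> P2"
    and v: "0 \<le> v" "upper_bounded_elem V v" and Q0: "near (c *\<^sub>R v) (Q 0) 0" "0 < c"
    and x: "x \<in> P1"
  shows "Q (2 *\<^sub>R x) = 4 *\<^sub>R Q x"
proof -
  have 0: "0 \<in> P1" using P by (rule subcone_zero)
  have "Q (0 + 0) + Q 0 = 2 *\<^sub>R Q 0 + 2 *\<^sub>R Q 0"
    using Q(1) 0 unfolding quadratic_on_def by (metis add.left_neutral)
  then have "2 *\<^sub>R Q 0 = 4 *\<^sub>R Q 0"
    using cone_scale_add_left[of 2 2 "Q 0"] by (simp add: cone_scale_two)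
  then have "(1/4) *\<^sub>R (2 *\<^sub>R Q 0) = (1/4) *\<^sub>R (4 *\<^sub>R Q 0)" by simp
  then have half: "(1/2) *\<^sub>R Q 0 = Q 0" by (simp add: cone_scale_scale cone_scale_one)
  have "near ((c / 2 ^ n) *\<^sub>R v) (Q 0) 0" for n
  proof (induction n)
    case 0
    show ?case using Q0(1) by simp
  next
    case (Suc n)
    from near_scale[OF this, of "1/2"] show ?case
      using half Q0(2) by (simp add: cone_scale_scale cone_scale_zero_right mult.commute)
  qed
  moreover have "(\<lambda>n. c / 2 ^ n) \<longlonglongrightarrow> 0" using LIMSEQ_divide_realpow_zero[of 2 c] by simp
  ultimately have "Q 0 = 0"
    using near_scale_tendsto_zero_imp_eq[OF V(1,2) _ V(3) v] Q(2) 0 Q0(2)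
    by (smt (verit, best) PiE divide_nonneg_nonneg zero_le_power)
  \<comment> \<open>The quadratic equation with \<open>y = 0\<close> and
    \<open>z = x\<close>.\<close>
  moreover have "Q (x + x) + Q 0 = 2 *\<^sub>R Q x + 2 *\<^sub>R Q x"
    using Q(1) x 0 unfolding quadratic_on_def by (metis add.right_neutral)
  ultimately show ?thesis using cone_scale_add_left[of 2 2 "Q x"] by (simp add: cone_scale_two)
qed

text \<open>The bound is uniform on \<open>P1\<close>: using it at \<open>2 *\<^sub>R x\<close> and
  scaling by 1/4 improves it at \<open>x\<close> by the factor 4. The induction therefore quantifies
  over all points.\<close>

lemma double_homogeneous_near_imp_eq:
  assumes P: "subcone P1" and V: "abstract_nbhd_system F V" "separated_cone P2 V"
    and v: "0 \<le> v" "upper_bounded_elem V v" and QP: "Q \<in> P1 \<rightarrow> P2" "Q' \<in> P1 \<rightarrow> P2"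
    and Q: "\<And>x. x \<in> P1 \<Longrightarrow> Q (2 *\<^sub>R x) = 4 *\<^sub>R Q x" "\<And>x. x \<in> P1 \<Longrightarrow> Q' (2 *\<^sub>R x) = 4 *\<^sub>R Q' x"
    and near: "\<And>x. x \<in> P1 \<Longrightarrow> near (c *\<^sub>R v) (Q x) (Q' x)" and "0 \<le> c" and x: "x \<in> P1"
  shows "Q x = Q' x"
proof -
  have "\<forall>x\<in>P1. near ((c / 4 ^ n) *\<^sub>R v) (Q x) (Q' x)" for n
  proof (induction n)
    case 0
    show ?case using near by simp
  next
    case (Suc n)
    show ?case
    proof
      fix x assume x: "x \<in> P1"
      then have "2 *\<^sub>R x \<in> P1" using P by (simp add: subcone_def)
      with Suc have "near ((c / 4 ^ n) *\<^sub>R v) (4 *\<^sub>R Q x) (4 *\<^sub>R Q' x)" using Q x by metis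
      from near_scale[OF this, of "1/4"] show "near ((c / 4 ^ Suc n) *\<^sub>R v) (Q x) (Q' x)"
        using \<open>0 \<le> c\<close> by (simp add: cone_scale_scale cone_scale_one mult.commute)
    qed
  qed
  then show ?thesis
    using near_scale_tendsto_zero_imp_eq[OF V _ _ v tendsto_const_div_4_power[of c]] QP x \<open>0 \<le> c\<close>
    by (simp add: Pi_iff)
qed

section \<open>Existence and uniqueness of the quadratic approximation\<close>

theorem theorem2p5:
  fixes P1 V1 :: "'a::preordered_cone set"
    and P2 V2 :: "'b::preordered_cone set"
    and v :: 'b
    and f :: "'a \<Rightarrow> 'b"
  assumes "locally_convex_cone P1 V1"
    and "full_locally_convex_cone P2 V2"
    and "separated_cone P2 V2"
    and "sym_complete P2 V2"
    and "v \<in> V2"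
    and "bounded_elem V2 v"
    and "f \<in> P1 \<rightarrow> P2"
    and "\<forall>x\<in>P1. \<forall>y\<in>P1. \<forall>z\<in>P1. x = y + z \<longrightarrow>
           2 *\<^sub>R f ((1/2) *\<^sub>R (x + y)) + 2 *\<^sub>R f ((1/2) *\<^sub>R z) \<in> sym_nbhd P2 v (f x + f y)"
    and "bounded_elem V2 (f 0)"
  shows "\<exists>!Q. Q \<in> P1 \<rightarrow>\<^sub>E P2 \<and> quadratic_on P1 Q \<and>
           (\<exists>\<gamma>>0. \<forall>x\<in>P1. Q x \<in> sym_nbhd P2 (\<gamma> *\<^sub>R v) (f x))"
proof -
  have P1: "subcone P1" and P2: "subcone P2" and V: "abstract_nbhd_system P2 V2"
    using assms(1,2) by (auto simp: locally_convex_cone_def full_locally_convex_cone_def)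
  have v: "0 \<le> v" "upper_bounded_elem V2 v"
    using V assms(5,6) by (auto simp: abstract_nbhd_system_def bounded_elem_def less_imp_le)
  have P1s: "r *\<^sub>R x \<in> P1" if "x \<in> P1" "0 \<le> r" for r x using P1 that by (simp add: subcone_def)
  have P2s: "r *\<^sub>R x \<in> P2" if "x \<in> P2" "0 \<le> r" for r x using P2 that by (simp add: subcone_def)
  have P1a: "x + y \<in> P1" if "x \<in> P1" "y \<in> P1" for x y using P1 that by (simp add: subcone_def)
  have P2a: "x + y \<in> P2" if "x \<in> P2" "y \<in> P2" for x y using P2 that by (simp add: subcone_def)
  have fP: "f x \<in> P2" if "x \<in> P1" for x using assms(7) that by blast
  have 01: "0 \<in> P1" and 02: "0 \<in> P2" using subcone_zero P1 P2 by auto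
  obtain b where b: "0 < b" "near (b *\<^sub>R v) (f 0) 0"
    using bounded_elem_near_zero[OF assms(9,5) v(1)] .
  have eqn: "near v (2 *\<^sub>R f ((1/2) *\<^sub>R (x + y)) + 2 *\<^sub>R f ((1/2) *\<^sub>R z)) (f x + f y)"
    if "x \<in> P1" "y \<in> P1" "z \<in> P1" "x = y + z" for x y z
    using assms(8) that by (simp add: sym_nbhd_iff_near)
  have dbl: "near ((1 + b) *\<^sub>R v) (4 *\<^sub>R f x) (f (2 *\<^sub>R x))" if x: "x \<in> P1" for x
  proof -
    \<comment> \<open>The hypothesis at the points \<open>2 *\<^sub>R x\<close> and 0, with
      difference \<open>2 *\<^sub>R x\<close>; both halved arguments are \<open>x\<close>.\<close>
    have "near v (2 *\<^sub>R f x + 2 *\<^sub>R f x) (f (2 *\<^sub>R x) + f 0)"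
      using eqn[OF P1s[OF x, of 2] 01 P1s[OF x, of 2]]
      by (simp add: cone_scale_scale cone_scale_one)
    then have "near (1 *\<^sub>R v) (4 *\<^sub>R f x) (f (2 *\<^sub>R x) + f 0)"
      using cone_scale_add_left[of 2 2 "f x"] by (simp add: cone_scale_one)
    moreover have "near (b *\<^sub>R v) (f (2 *\<^sub>R x) + f 0) (f (2 *\<^sub>R x))"
      using near_add[OF near_refl[OF order_refl, of "f (2 *\<^sub>R x)"] b(2)] by simp
    ultimately show ?thesis using b(1) by (intro near_trans_scale) auto
  qed
  define q where "q x n = (1 / 4 ^ n) *\<^sub>R f (2 ^ n *\<^sub>R x)" for x and n :: nat
  \<comment> \<open>Chosen so that \<open>d / 4 ^ n\<close> is the sum of the step errors
    \<open>(1 + b) / 4 ^ (k + 1)\<close> over all \<open>k \<ge> n\<close>.\<close>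
  define d where "d = (1 + b) / 3"
  have d: "0 < d" using b(1) by (simp add: d_def)
  have qP: "q x n \<in> P2" if "x \<in> P1" for x n using P1s P2s fP that by (simp add: q_def)
  have "\<exists>a\<in>P2. seq_lim V2 (q x) a \<and> near ((d + 1) *\<^sub>R v) a (f x)" if x: "x \<in> P1" for x
  proof -
    have step: "near ((d / 4 ^ n - d / 4 ^ Suc n) *\<^sub>R v) (q x n) (q x (Suc n))" for n
    proof -
      have "(1 / 4 ^ Suc n) * (1 + b) = d / 4 ^ n - d / 4 ^ Suc n"
        by (simp add: d_def field_simps)
      then show ?thesis
        using near_scale[OF dbl[OF P1s[OF x, of "2 ^ n"]], of "1 / 4 ^ Suc n"] b(1)
        by (simp add: q_def cone_scale_scale)
    qed
    have "decseq (\<lambda>n. d / 4 ^ n)"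
      using d by (auto intro!: decseq_SucI simp: field_simps)
    from sym_complete_telescope[OF V assms(4) _ assms(5) v(2) this tendsto_const_div_4_power step]
    obtain a where "a \<in> P2" "seq_lim V2 (q x) a" "near ((d + 1) *\<^sub>R v) a (q x 0)"
      using qP x by auto
    then show ?thesis by (auto simp: q_def cone_scale_one)
  qed
  then obtain Q0 where Q0: "\<And>x. x \<in> P1 \<Longrightarrow>
      Q0 x \<in> P2 \<and> seq_lim V2 (q x) (Q0 x) \<and> near ((d + 1) *\<^sub>R v) (Q0 x) (f x)"
    by metis
  \<comment> \<open>Restriction fixes the values outside \<open>P1\<close>, which makes uniqueness
    as a total function possible.\<close>
  define Q where "Q = restrict Q0 P1"
  have QP: "Q x \<in> P2" and Qlim: "seq_lim V2 (q x) (Q x)"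
    and Qf: "near ((d + 1) *\<^sub>R v) (Q x) (f x)" if "x \<in> P1" for x
    using Q0 that by (auto simp: Q_def)
  have Qdbl: "Q (2 *\<^sub>R x) = 4 *\<^sub>R Q x" if x: "x \<in> P1" for x
  \<comment> \<open>\<open>q (2 *\<^sub>R x) n\<close> equals
    \<open>4 *\<^sub>R q x (Suc n)\<close>: doubling the argument is an index shift.\<close>
  proof (rule seq_lim_unique[OF V assms(3)])
    show "seq_lim V2 (\<lambda>n. 4 *\<^sub>R q x (Suc n)) (4 *\<^sub>R Q x)"
      using Qlim[OF x] unfolding seq_lim_def
      by (intro seq_lim_scale[OF V, unfolded seq_lim_def])
        (auto simp: eventually_sequentially_Suc[of "\<lambda>n. near _ (q x n) _"])
    show "\<forall>\<^sub>F n in sequentially. near w (q (2 *\<^sub>R x) n) (4 *\<^sub>R q x (Suc n))" if "w \<in> V2" for w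
    proof -
      have "0 \<le> w" using V that by (auto simp: abstract_nbhd_system_def less_imp_le)
      then show ?thesis by (simp add: q_def cone_scale_scale near_refl mult.commute)
    qed
  qed (use x QP P1s P2s Qlim in auto)
  have Qquad: "quadratic_on P1 Q"
    unfolding quadratic_on_def
  proof (intro ballI impI)
    fix x y z assume P: "x \<in> P1" "y \<in> P1" "z \<in> P1" and xyz: "x = y + z"
    define m where "m = (1/2) *\<^sub>R (x + y)"
    define h where "h = (1/2) *\<^sub>R z"
    have mh: "m \<in> P1" "h \<in> P1" "x + y = 2 *\<^sub>R m" "z = 2 *\<^sub>R h"
      using P P1s P1a by (auto simp: m_def h_def cone_scale_scale cone_scale_one)
    \<comment> \<open>The relation \<open>x = y + z\<close> survives scaling by
      \<open>2 ^ n\<close>, so the hypothesis applies to the scaled points; dividing by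
      \<open>4 ^ n\<close> shrinks its error as well.\<close>
    have near: "near ((1 / 4 ^ n) *\<^sub>R v) (2 *\<^sub>R q m n + 2 *\<^sub>R q h n) (q x n + q y n)" for n
    proof -
      let ?t = "2 ^ n :: real"
      have "near v (2 *\<^sub>R f (?t *\<^sub>R m) + 2 *\<^sub>R f (?t *\<^sub>R h)) (f (?t *\<^sub>R x) + f (?t *\<^sub>R y))"
        using eqn[of "?t *\<^sub>R x" "?t *\<^sub>R y" "?t *\<^sub>R z"] P1s[OF P(1)] P1s[OF P(2)] P1s[OF P(3)]
        by (simp add: m_def h_def xyz cone_scale_add_right cone_scale_scale mult.commute)
      from near_scale[OF this, of "1 / 4 ^ n"] show ?thesis
        by (simp add: q_def cone_scale_add_right cone_scale_scale mult.commute)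
    qed
    have "2 *\<^sub>R Q m + 2 *\<^sub>R Q h = Q x + Q y"
    proof (rule seq_lim_unique[OF V assms(3)])
      show "seq_lim V2 (\<lambda>n. 2 *\<^sub>R q m n + 2 *\<^sub>R q h n) (2 *\<^sub>R Q m + 2 *\<^sub>R Q h)"
        using mh by (intro seq_lim_add[OF V] seq_lim_scale[OF V] Qlim) auto
      show "seq_lim V2 (\<lambda>n. q x n + q y n) (Q x + Q y)"
        using P by (intro seq_lim_add[OF V] Qlim)
      show "\<forall>\<^sub>F n in sequentially. near w (2 *\<^sub>R q m n + 2 *\<^sub>R q h n) (q x n + q y n)"
        if "w \<in> V2" for w
        by (rule eventually_mono[OF upper_bounded_scale_tendsto_zero[OF V v that
                tendsto_const_div_4_power[of 1]]]) (use near_mono[OF near] in auto)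
    qed (use P mh QP P2s P2a in auto)
    \<comment> \<open>Doubling produces \<open>4 *\<^sub>R Q m\<close> and
      \<open>4 *\<^sub>R Q h\<close>, which \<open>Qdbl\<close> identifies with
      \<open>Q (x + y)\<close> and \<open>Q z\<close>.\<close>
    then have "2 *\<^sub>R (2 *\<^sub>R Q m + 2 *\<^sub>R Q h) = 2 *\<^sub>R (Q x + Q y)" by simp
    then show "Q (x + y) + Q z = 2 *\<^sub>R Q x + 2 *\<^sub>R Q y"
      using Qdbl mh by (simp add: cone_scale_add_right cone_scale_scale)
  qed
  show ?thesis
  proof (rule ex1I[of _ Q])
    have "0 < d + 1" using d by simp
    then show "Q \<in> P1 \<rightarrow>\<^sub>E P2 \<and> quadratic_on P1 Q \<and>
        (\<exists>\<gamma>>0. \<forall>x\<in>P1. Q x \<in> sym_nbhd P2 (\<gamma> *\<^sub>R v) (f x))"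
      using Qquad QP Qf by (auto simp: sym_nbhd_iff_near Q_def)
  next
    fix Q' assume Q': "Q' \<in> P1 \<rightarrow>\<^sub>E P2 \<and> quadratic_on P1 Q' \<and>
        (\<exists>\<gamma>>0. \<forall>x\<in>P1. Q' x \<in> sym_nbhd P2 (\<gamma> *\<^sub>R v) (f x))"
    then obtain g where g: "0 < g" "\<And>x. x \<in> P1 \<Longrightarrow> near (g *\<^sub>R v) (Q' x) (f x)"
      by (auto simp: sym_nbhd_iff_near)
    \<comment> \<open>This is where boundedness of \<open>f 0\<close> enters uniqueness:
      \<open>Q' 0\<close> is compared with zero through \<open>f 0\<close>.\<close>
    have "near ((g + b) *\<^sub>R v) (Q' 0) 0"
      using near_trans_scale[OF g(2)[OF 01] b(2)] g(1) b(1) by simp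
    then have Q'dbl: "Q' (2 *\<^sub>R x) = 4 *\<^sub>R Q' x" if "x \<in> P1" for x
      using quadratic_on_double[OF P1 _ _ V assms(3) 02 v, of Q' "g + b"] Q' g(1) b(1) that
      by auto
    have close: "near ((g + (d + 1)) *\<^sub>R v) (Q' x) (Q x)" if "x \<in> P1" for x
      using near_trans_scale[OF g(2) near_sym[OF Qf]] that g(1) d by simp
    have "Q' x = Q x" if "x \<in> P1" for x
    proof (rule double_homogeneous_near_imp_eq[OF P1 V assms(3) v])
      show "near ((g + (d + 1)) *\<^sub>R v) (Q' x) (Q x)" if "x \<in> P1" for x
        using close[OF that] .
    qed (use Q' QP Q'dbl Qdbl that g(1) d in auto)
    then show "Q' = Q" using Q' QP by (intro PiE_ext[of Q' P1 "\<lambda>_. P2" Q]) (auto simp: Q_def)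
  qed
qed

end
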